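(* Let $G_1$ be an $r_1$-regular graph on $n_1$ vertices and $m_1$ edges, and $G_2$ an arbitrary graph on $n_2$ vertices. Then $$\phi(L(G_1 \ominus G_2); x) = (x^2-(3+n_2)x+2)^{m_1-n_1} \cdot \prod_{i=2}^{n_2} (x-1-\mu_i(G_2))^{m_1} \cdot \prod_{i=1}^{n_1} \left( x^3 - (3+r_1+n_2)x^2 + (2+r_1+r_1n_2+\mu_i(G_1))x - \mu_i(G_1) \right).$$
   Context: All graphs are finite, simple and undirected. For a graph $G$, $A(G)$ is its adjacency matrix, $D(G)$ the diagonal matrix of degrees, $L(G)=D(G)-A(G)$ its Laplacian matrix; $\phi(M;x)=\det(xI-M)$. The Laplacian eigenvalues of a graph $G$ on $n$ vertices are $0=\mu_1(G)\le\dots\le\mu_n(G)$. The subdivision graph $\mathcal{S}(G)$ is obtained from $G$ by inserting a new vertex into every edge of $G$; $I(G)$ denotes the set of these inserted vertices. The subdivision-edge corona $G_1\ominus G_2$ of two vertex-disjoint graphs is the graph obtained from $\mathcal{S}(G_1)$ and $|I(G_1)|$ copies of $G_2$, all vertex-disjoint, by joining the $i$th vertex of $I(G_1)$ to every vertex in the $i$th copy of $G_2$. *)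

theory Defs
  imports
    "Graph_Theory.Pair_Digraph"
    "Jordan_Normal_Form.Char_Poly"
    "HOL-Computational_Algebra.Polynomial_Factorial"
begin

text \<open>
  A finite simple undirected graph is a \<^const>\<open>pair_graph\<close>: a finite, loop-free, symmetric
  digraph without parallel arcs. Each undirected edge is represented by two opposite arcs, so
  undirected edges are the two-element sets of end points, and the degree of a vertex is its
  \<^const>\<open>out_degree\<close>.
\<close>

definition uedges :: "'a pair_pre_digraph \<Rightarrow> 'a set set" where
  "uedges G = {{u, v} | u v. (u, v) \<in> parcs G}"

definition regular_graph :: "nat \<Rightarrow> 'a pair_pre_digraph \<Rightarrow> bool" where
  "regular_graph r G \<longleftrightarrow> (\<forall>v \<in> pverts G. out_degree (with_proj G) v = r)"

definition enumerates :: "'a list \<Rightarrow> 'a pair_pre_digraph \<Rightarrow> bool" where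
  "enumerates vs G \<longleftrightarrow> distinct vs \<and> set vs = pverts G"

text \<open>
  Matrices are indexed by \<open>0..<length vs\<close>, where \<open>vs\<close> enumerates the vertices of \<open>G\<close>.
\<close>

definition adjacency_mat :: "'a list \<Rightarrow> 'a pair_pre_digraph \<Rightarrow> real mat" where
  "adjacency_mat vs G = mat (length vs) (length vs)
     (\<lambda>(i, j). if (vs ! i, vs ! j) \<in> parcs G then 1 else 0)"

definition degree_mat :: "'a list \<Rightarrow> 'a pair_pre_digraph \<Rightarrow> real mat" where
  "degree_mat vs G = mat (length vs) (length vs)
     (\<lambda>(i, j). if i = j then real (out_degree (with_proj G) (vs ! i)) else 0)"

definition laplacian_mat :: "'a list \<Rightarrow> 'a pair_pre_digraph \<Rightarrow> real mat" where
  "laplacian_mat vs G = degree_mat vs G - adjacency_mat vs G"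

text \<open>
  \<open>laplacian_eig vs G i\<close> is the \<open>i\<close>-th smallest Laplacian eigenvalue, \<open>i\<close> counting from 1;
  eigenvalues are repeated according to their multiplicity as roots of the characteristic
  polynomial.
\<close>

definition laplacian_eig :: "'a list \<Rightarrow> 'a pair_pre_digraph \<Rightarrow> nat \<Rightarrow> real" where
  "laplacian_eig vs G i =
     sorted_list_of_multiset (proots (char_poly (laplacian_mat vs G))) ! (i - 1)"

text \<open>
  In the subdivision graph, \<open>Inl v\<close> is the old vertex \<open>v\<close> and \<open>Inr e\<close> the vertex inserted into
  the edge \<open>e\<close>.
\<close>

definition inserted_vertices :: "'a pair_pre_digraph \<Rightarrow> ('a + 'a set) set" where
  "inserted_vertices G = Inr ` uedges G"

definition subdivision_graph :: "'a pair_pre_digraph \<Rightarrow> ('a + 'a set) pair_pre_digraph" where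
  "subdivision_graph G =
     \<lparr> pverts = Inl ` pverts G \<union> inserted_vertices G,
       parcs = {(Inl v, Inr e) | v e. e \<in> uedges G \<and> v \<in> e}
             \<union> {(Inr e, Inl v) | v e. e \<in> uedges G \<and> v \<in> e} \<rparr>"

text \<open>
  The copies of \<open>H\<close> are indexed by the inserted vertices of \<open>G\<close> themselves: \<open>Inr (w, u)\<close> is the
  vertex \<open>u\<close> in the copy of \<open>H\<close> belonging to the inserted vertex \<open>w\<close>. The sum type makes the
  subdivision graph and all copies vertex-disjoint.
\<close>

definition subdivision_edge_corona ::
  "'a pair_pre_digraph \<Rightarrow> 'b pair_pre_digraph \<Rightarrow>
     (('a + 'a set) + ('a + 'a set) \<times> 'b) pair_pre_digraph" where
  "subdivision_edge_corona G H =
     \<lparr> pverts = Inl ` pverts (subdivision_graph G) \<union> Inr ` (inserted_vertices G \<times> pverts H),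
       parcs = {(Inl a, Inl b) | a b. (a, b) \<in> parcs (subdivision_graph G)}
             \<union> {(Inr (w, u), Inr (w, v)) | w u v. w \<in> inserted_vertices G \<and> (u, v) \<in> parcs H}
             \<union> {(Inl w, Inr (w, u)) | w u. w \<in> inserted_vertices G \<and> u \<in> pverts H}
             \<union> {(Inr (w, u), Inl w) | w u. w \<in> inserted_vertices G \<and> u \<in> pverts H} \<rparr>"

lemma uedges_subset:
  assumes "pair_graph G" "e \<in> uedges G" "v \<in> e"
  shows "v \<in> pverts G"
proof -
  interpret pair_graph G by fact
  show ?thesis using assms(2,3) by (auto simp: uedges_def dest: in_arcsD1 in_arcsD2)
qed

lemma pair_graphI:
  assumes "finite (pverts G)" "parcs G \<subseteq> pverts G \<times> pverts G" "sym (parcs G)" "irrefl (parcs G)"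
  shows "pair_graph G"
proof
  show "finite (parcs G)" using assms(1,2) by (meson finite_SigmaI finite_subset)
qed (use assms in \<open>auto simp: symmetric_def irrefl_def\<close>)

lemma finite_uedges:
  assumes "pair_graph G"
  shows "finite (uedges G)"
proof -
  interpret pair_graph G by fact
  have "uedges G = (\<lambda>(u, v). {u, v}) ` parcs G" by (auto simp: uedges_def image_iff)
  then show ?thesis using pair_finite_arcs by simp
qed

lemma pair_graph_subdivision_graph:
  assumes "pair_graph G"
  shows "pair_graph (subdivision_graph G)"
proof (rule pair_graphI)
  interpret pair_graph G by fact
  show "finite (pverts (subdivision_graph G))"
    using finite_uedges[OF assms] pair_finite_verts
    by (simp add: subdivision_graph_def inserted_vertices_def)
qed (use uedges_subset[OF assms] in
      \<open>auto simp: subdivision_graph_def inserted_vertices_def sym_def irrefl_def\<close>)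

lemma pair_graph_subdivision_edge_corona:
  assumes "pair_graph G" "pair_graph H"
  shows "pair_graph (subdivision_edge_corona G H)"
proof (rule pair_graphI)
  interpret S: pair_graph "subdivision_graph G"
    by (rule pair_graph_subdivision_graph) fact
  interpret H: pair_graph H by fact
  have I: "inserted_vertices G \<subseteq> pverts (subdivision_graph G)"
    by (simp add: subdivision_graph_def)
  have "finite (inserted_vertices G)" using I S.pair_finite_verts by (rule finite_subset)
  then show "finite (pverts (subdivision_edge_corona G H))"
    using S.pair_finite_verts H.pair_finite_verts by (simp add: subdivision_edge_corona_def)
  show "parcs (subdivision_edge_corona G H) \<subseteq>
      pverts (subdivision_edge_corona G H) \<times> pverts (subdivision_edge_corona G H)"
    using I by (auto simp: subdivision_edge_corona_def dest: S.in_arcsD1 S.in_arcsD2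
        H.in_arcsD1 H.in_arcsD2)
  have "sym (parcs (subdivision_graph G))" "sym (parcs H)"
    using S.pair_sym_arcs H.pair_sym_arcs by (simp_all add: symmetric_def)
  then show "sym (parcs (subdivision_edge_corona G H))"
    by (auto simp: subdivision_edge_corona_def sym_def)
  show "irrefl (parcs (subdivision_edge_corona G H))"
    using S.pair_no_loops H.pair_no_loops
    by (fastforce simp: subdivision_edge_corona_def irrefl_def)
qed

end

theory Submission
  imports Defs
begin

text \<open>
  Compute over the field of rational functions. Since every row of \<open>L(G\<^sub>2)\<close> sums to 0,
  subtracting \<open>1 / (x - 1)\<close> times the columns of a copy of \<open>G\<^sub>2\<close> from the column of its inserted
  vertex splits the copies off, and turns the diagonal entry \<open>x - 2 - n\<^sub>2\<close> of an inserted vertex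
  into the pivot \<open>c = x - 2 - n\<^sub>2 - n\<^sub>2 / (x - 1)\<close>, where \<open>c (x - 1) = x\<^sup>2 - (3 + n\<^sub>2) x + 2\<close>.
  Eliminating the inserted vertices next leaves \<open>(x - r\<^sub>1) I - R R\<^sup>T / c\<close> with the incidence
  matrix \<open>R\<close>, and by regularity \<open>R R\<^sup>T = 2 r\<^sub>1 I - L(G\<^sub>1)\<close>. It remains to evaluate the
  characteristic polynomials of \<open>L(G\<^sub>1)\<close> and \<open>L(G\<^sub>2)\<close>, which split over the reals with
  nonnegative roots since Laplacians are positive semidefinite. As \<open>\<mu>\<^sub>1(G\<^sub>2) = 0\<close>, each copy
  contributes a factor \<open>x - 1\<close>, which turns a pivot into the quadratic factor.
\<close>

section \<open>Determinants indexed by finite sets\<close>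

definition det_on :: "'a set \<Rightarrow> ('a \<Rightarrow> 'a \<Rightarrow> 'k :: comm_ring_1) \<Rightarrow> 'k" where
  "det_on S f = (\<Sum>p | p permutes S. of_int (sign p) * (\<Prod>a\<in>S. f a (p a)))"

lemma det_on_cong:
  assumes "\<And>a b. a \<in> S \<Longrightarrow> b \<in> S \<Longrightarrow> f a b = g a b"
  shows "det_on S f = det_on S g"
  unfolding det_on_def using assms
  by (intro sum.cong prod.cong arg_cong2[of _ _ _ _ "(*)"]) (auto simp: permutes_in_image)

lemma det_on_image:
  assumes "finite S" "inj_on h S"
  shows "det_on (h ` S) f = det_on S (\<lambda>a b. f (h a) (h b))"
proof -
  have h: "bij_betw h S (h ` S)" and h': "bij_betw (inv_into S h) (h ` S) S"
    using assms(2) by (simp_all add: inj_on_imp_bij_betw bij_betw_inv_into)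
  show ?thesis unfolding det_on_def
  proof (rule sum.reindex_bij_witness[of _ "map_permutation S h"
        "map_permutation (h ` S) (inv_into S h)"])
    fix p assume p: "p \<in> {p. p permutes h ` S}"
    define q where "q = map_permutation (h ` S) (inv_into S h) p"
    have q: "q permutes S" "map_permutation S h q = p"
      using p map_permutation_permutes[OF h'] map_permutation_compose_inv[OF h', of p h]
      by (auto simp: q_def f_inv_into_f)
    then show "q \<in> {p. p permutes S}" "map_permutation S h q = p"
      by simp_all
    have "(\<Prod>a\<in>h ` S. f a (p a)) = (\<Prod>a\<in>S. f (h a) (h (q a)))"
      using assms(2) map_permutation_apply[OF assms(2), of _ q] q(2) by (simp add: prod.reindex)
    then show "of_int (sign q) * (\<Prod>a\<in>S. f (h a) (h (q a))) =
        of_int (sign p) * (\<Prod>a\<in>h ` S. f a (p a))"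
      using sign_map_permutation[OF assms(2) q(1) assms(1)] q(2) by simp
  next
    fix q assume "q \<in> {p. p permutes S}"
    then show "map_permutation (h ` S) (inv_into S h) (map_permutation S h q) = q"
      "map_permutation S h q \<in> {p. p permutes h ` S}"
      using map_permutation_compose_inv[OF h, of q "inv_into S h"] map_permutation_permutes[OF h]
        assms(2) by simp_all
  qed
qed

lemma det_on_smult: "det_on S (\<lambda>a b. c * f a b) = c ^ card S * det_on S f"
  by (simp add: det_on_def prod.distrib sum_distrib_left mult_ac)

lemma det_on_empty [simp]: "det_on {} f = 1"
  by (simp add: det_on_def)

lemma det_on_singleton [simp]: "det_on {a} f = f a a"
  by (simp add: det_on_def)

definition list_mat :: "'a list \<Rightarrow> 'b list \<Rightarrow> ('a \<Rightarrow> 'b \<Rightarrow> 'k) \<Rightarrow> 'k mat" where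
  "list_mat rs cs f = mat (length rs) (length cs) (\<lambda>(i, j). f (rs ! i) (cs ! j))"

lemma list_mat_carrier [simp]: "list_mat rs cs f \<in> carrier_mat (length rs) (length cs)"
  by (simp add: list_mat_def)

lemma index_list_mat [simp]:
  "i < length rs \<Longrightarrow> j < length cs \<Longrightarrow> list_mat rs cs f $$ (i, j) = f (rs ! i) (cs ! j)"
  by (simp add: list_mat_def)

lemma det_on_set:
  assumes "distinct vs"
  shows "det_on (set vs) f = det (list_mat vs vs f)"
proof -
  have "set vs = nth vs ` {0..<length vs}"
    by (auto simp: in_set_conv_nth)
  moreover have "inj_on (nth vs) {0..<length vs}"
    using assms by (simp add: inj_on_nth)
  ultimately have "det_on (set vs) f = det_on {0..<length vs} (\<lambda>i j. f (vs ! i) (vs ! j))"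
    by (simp only: det_on_image finite_atLeastLessThan)
  also have "\<dots> = det_on {0..<length vs} (\<lambda>i j. list_mat vs vs f $$ (i, j))"
    by (rule det_on_cong) simp
  also have "\<dots> = det (list_mat vs vs f)"
    by (simp add: det_def'[OF list_mat_carrier] det_on_def)
  finally show ?thesis .
qed

lemma sum_nth_distinct:
  assumes "distinct vs"
  shows "(\<Sum>i = 0..<length vs. g (vs ! i)) = sum g (set vs)"
  using sum.reindex_bij_betw[OF bij_betw_nth[OF assms refl refl], of g]
  by (simp add: atLeast0LessThan)

lemma det_on_mult:
  assumes "finite S"
  shows "det_on S f * det_on S g = det_on S (\<lambda>a b. \<Sum>k\<in>S. f a k * g k b)"
proof -
  obtain vs where vs: "distinct vs" "set vs = S"
    using finite_distinct_list[OF assms] by blast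
  have "list_mat vs vs f * list_mat vs vs g = list_mat vs vs (\<lambda>a b. \<Sum>k\<in>set vs. f a k * g k b)"
    by (rule eq_matI)
      (simp_all add: list_mat_def scalar_prod_def sum_nth_distinct[OF vs(1), symmetric])
  then show ?thesis
    using det_mult[OF list_mat_carrier[of vs vs f] list_mat_carrier[of vs vs g]]
    by (simp add: det_on_set[OF vs(1)] flip: vs(2))
qed

lemma det_on_lower_left_zero:
  fixes f :: "'a \<Rightarrow> 'a \<Rightarrow> 'k :: idom"
  assumes "finite S" "finite T" "S \<inter> T = {}"
    and zero: "\<And>a b. a \<in> T \<Longrightarrow> b \<in> S \<Longrightarrow> f a b = 0"
  shows "det_on (S \<union> T) f = det_on S f * det_on T f"
proof -
  obtain vs ws where vs: "distinct vs" "set vs = S" and ws: "distinct ws" "set ws = T"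
    using finite_distinct_list assms(1,2) by metis
  have lower_left: "list_mat ws vs f = 0\<^sub>m (length ws) (length vs)"
    using zero vs ws by (auto simp: list_mat_def intro!: eq_matI)
  have "list_mat (vs @ ws) (vs @ ws) f =
      four_block_mat (list_mat vs vs f) (list_mat vs ws f) (list_mat ws vs f) (list_mat ws ws f)"
    by (rule eq_matI) (auto simp: list_mat_def nth_append)
  then have "det (list_mat (vs @ ws) (vs @ ws) f) =
      det (list_mat vs vs f) * det (list_mat ws ws f)"
    using det_four_block_mat_lower_left_zero[OF list_mat_carrier list_mat_carrier lower_left
        list_mat_carrier] by simp
  then show ?thesis
    using det_on_set[of "vs @ ws" f] det_on_set[of vs f] det_on_set[of ws f] vs ws assms(3) by simp
qed

lemma det_on_diag:
  fixes d :: "'a \<Rightarrow> 'k :: idom"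
  assumes "finite S"
  shows "det_on S (\<lambda>a b. if a = b then d a else 0) = prod d S"
  using assms
proof (induction S rule: finite_induct)
  case (insert a S)
  have "det_on ({a} \<union> S) (\<lambda>a b. if a = b then d a else 0) =
      det_on {a} (\<lambda>a b. if a = b then d a else 0) * det_on S (\<lambda>a b. if a = b then d a else 0)"
    by (rule det_on_lower_left_zero) (use insert in auto)
  then show ?case using insert by simp
qed simp

lemma det_on_block_diag:
  fixes g :: "'b \<Rightarrow> 'b \<Rightarrow> 'k :: idom"
  assumes "finite I" "finite S"
  shows "det_on (I \<times> S) (\<lambda>p q. if fst p = fst q then g (snd p) (snd q) else 0) =
    det_on S g ^ card I"
  using assms(1)
proof (induction I rule: finite_induct)
  case (insert i I)
  let ?f = "\<lambda>p q. if fst p = fst q then g (snd p) (snd q) else 0"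
  have "insert i I \<times> S = Pair i ` S \<union> I \<times> S" by auto
  then have "det_on (insert i I \<times> S) ?f = det_on (Pair i ` S) ?f * det_on (I \<times> S) ?f"
    using insert.hyps assms(2) by (auto intro: det_on_lower_left_zero)
  also have "det_on (Pair i ` S) ?f = det_on S g"
    using assms(2) by (simp add: det_on_image inj_on_def)
  finally show ?case using insert by simp
qed simp

lemma det_on_add_columns:
  fixes f :: "'a \<Rightarrow> 'a \<Rightarrow> 'k :: idom"
  assumes "finite S" "finite T" "S \<inter> T = {}"
  shows "det_on (S \<union> T) (\<lambda>a b. f a b + (if b \<in> S then \<Sum>k\<in>T. f a k * W k b else 0)) =
    det_on (S \<union> T) f"
proof -
  define U where "U a b = (if a = b then 1 else if a \<in> T \<and> b \<in> S then W a b else 0)" for a b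
  have unit: "det_on X U = 1" if "finite X" "X \<subseteq> S \<or> X \<subseteq> T" for X
  proof -
    have "det_on X U = det_on X (\<lambda>a b. if a = b then 1 else 0)"
      using that(2) assms(3) by (intro det_on_cong) (auto simp: U_def)
    then show ?thesis using det_on_diag[OF that(1), of "\<lambda>_. 1 :: 'k"] by simp
  qed
  have "det_on (T \<union> S) U = det_on T U * det_on S U"
    using assms by (intro det_on_lower_left_zero) (auto simp: U_def)
  then have "det_on (S \<union> T) f = det_on (S \<union> T) (\<lambda>a b. \<Sum>k\<in>S \<union> T. f a k * U k b)"
    using det_on_mult[of "S \<union> T" f U] unit[of S] unit[of T] assms by (simp add: Un_commute)
  also have "\<dots> = det_on (S \<union> T) (\<lambda>a b. f a b + (if b \<in> S then \<Sum>k\<in>T. f a k * W k b else 0))"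
  proof (rule det_on_cong)
    fix a b assume b: "b \<in> S \<union> T"
    have "(\<Sum>k\<in>S \<union> T. f a k * U k b) =
        (\<Sum>k\<in>S \<union> T. (if k = b then f a k else 0)
          + (if k \<in> T then if b \<in> S then f a k * W k b else 0 else 0))"
      using assms(3) by (intro sum.cong) (auto simp: U_def)
    also have "\<dots> = f a b + (\<Sum>k\<in>T. if b \<in> S then f a k * W k b else 0)"
      using assms b by (simp add: sum.distrib sum.delta' sum.inter_restrict[symmetric] Int_absorb1)
    finally show "(\<Sum>k\<in>S \<union> T. f a k * U k b) = f a b + (if b \<in> S then \<Sum>k\<in>T. f a k * W k b else 0)"
      by simp
  qed
  finally show ?thesis by simp
qed

text \<open>
  The matrix \<open>W\<close> plays the role of \<open>D\<^sup>-\<^sup>1 C\<close> in the Schur complement \<open>A - B D\<^sup>-\<^sup>1 C\<close>.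
\<close>

lemma det_on_schur:
  fixes f :: "'a \<Rightarrow> 'a \<Rightarrow> 'k :: idom"
  assumes "finite S" "finite T" "S \<inter> T = {}"
    and W: "\<And>t s. t \<in> T \<Longrightarrow> s \<in> S \<Longrightarrow> f t s = (\<Sum>k\<in>T. f t k * W k s)"
  shows "det_on (S \<union> T) f = det_on S (\<lambda>a b. f a b - (\<Sum>k\<in>T. f a k * W k b)) * det_on T f"
proof -
  define g where "g a b = f a b + (if b \<in> S then \<Sum>k\<in>T. f a k * - W k b else 0)" for a b
  have g_S: "g a b = f a b - (\<Sum>k\<in>T. f a k * W k b)" if "b \<in> S" for a b
    using that by (simp add: g_def sum_negf)
  have "det_on (S \<union> T) f = det_on (S \<union> T) g"
    using det_on_add_columns[OF assms(1-3), of f "\<lambda>k b. - W k b"] by (simp add: g_def[abs_def])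
  also have "\<dots> = det_on S g * det_on T g"
    using assms(1-3) by (rule det_on_lower_left_zero) (simp add: g_S W[symmetric])
  also have "det_on S g = det_on S (\<lambda>a b. f a b - (\<Sum>k\<in>T. f a k * W k b))"
    by (rule det_on_cong) (simp add: g_S)
  also have "det_on T g = det_on T f"
    using assms(3) by (intro det_on_cong) (auto simp: g_def)
  finally show ?thesis .
qed

lemma det_on_schur_scalar_block:
  fixes f :: "'a + 'b \<Rightarrow> 'a + 'b \<Rightarrow> 'k :: field"
  assumes "finite V" "finite E" "c \<noteq> 0"
    and scalar: "\<And>e e'. e \<in> E \<Longrightarrow> e' \<in> E \<Longrightarrow> f (Inr e) (Inr e') = (if e = e' then c else 0)"
  shows "det_on (Inl ` V \<union> Inr ` E) f =
    det_on V (\<lambda>v w. f (Inl v) (Inl w) - (\<Sum>e\<in>E. f (Inl v) (Inr e) * f (Inr e) (Inl w)) / c)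
    * c ^ card E"
proof -
  define W where "W k b = f k b / c" for k b
  have "det_on (Inl ` V \<union> Inr ` E) f =
      det_on (Inl ` V) (\<lambda>a b. f a b - (\<Sum>k\<in>Inr ` E. f a k * W k b)) * det_on (Inr ` E) f"
  proof (rule det_on_schur)
    fix t s :: "'a + 'b" assume "t \<in> Inr ` E" "s \<in> Inl ` V"
    then obtain e where e: "t = Inr e" "e \<in> E" by blast
    have "(\<Sum>k\<in>Inr ` E. f t k * W k s) = (\<Sum>e'\<in>E. if e = e' then f (Inr e') s else 0)"
      unfolding e(1) using e(2) assms(3)
      by (simp add: sum.reindex W_def scalar) (rule sum.cong; simp)
    then show "f t s = (\<Sum>k\<in>Inr ` E. f t k * W k s)"
      using e assms(2) by simp
  qed (use assms(1,2) in auto)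
  also have "det_on (Inl ` V) (\<lambda>a b. f a b - (\<Sum>k\<in>Inr ` E. f a k * W k b)) =
      det_on V (\<lambda>v w. f (Inl v) (Inl w) - (\<Sum>e\<in>E. f (Inl v) (Inr e) * f (Inr e) (Inl w)) / c)"
    using assms(1) by (simp add: det_on_image sum.reindex W_def sum_divide_distrib)
  also have "det_on (Inr ` E) f = det_on E (\<lambda>e e'. if e = e' then c else 0)"
    using assms(2) scalar by (simp add: det_on_image cong: det_on_cong)
  also have "\<dots> = c ^ card E"
    using det_on_diag[OF assms(2), of "\<lambda>_. c"] by simp
  finally show ?thesis .
qed

lemma det_on_attach_copies:
  fixes f :: "'a + 'a \<times> 'b \<Rightarrow> 'a + 'a \<times> 'b \<Rightarrow> 'k :: field"
  assumes "finite V" "W \<subseteq> V" "finite S" "s \<noteq> 0"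
    and upper_right: "\<And>a w u. w \<in> W \<Longrightarrow> u \<in> S \<Longrightarrow> f (Inl a) (Inr (w, u)) = (if a = w then p else 0)"
    and lower_left: "\<And>a w u. w \<in> W \<Longrightarrow> u \<in> S \<Longrightarrow> f (Inr (w, u)) (Inl a) = (if a = w then q else 0)"
    and copies: "\<And>w u w' u'. w \<in> W \<Longrightarrow> u \<in> S \<Longrightarrow>
      f (Inr (w, u)) (Inr (w', u')) = (if w = w' then g u u' else 0)"
    and row_sums: "\<And>u. u \<in> S \<Longrightarrow> (\<Sum>v\<in>S. g u v) = s"
  shows "det_on (Inl ` V \<union> Inr ` (W \<times> S)) f =
    det_on V (\<lambda>a b. f (Inl a) (Inl b)
      - (if a = b \<and> a \<in> W then p * q * of_nat (card S) / s else 0))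
    * det_on S g ^ card W"
proof -
  have fin_W: "finite W" using assms(1,2) by (rule finite_subset[rotated])
  define X :: "'a + 'a \<times> 'b \<Rightarrow> 'a + 'a \<times> 'b \<Rightarrow> 'k"
    where "X k b = (if Inl (fst (projr k)) = b then q / s else 0)" for k b
  have sum_copies: "(\<Sum>k\<in>Inr ` (W \<times> S). f a k * X k (Inl b)) =
      (if b \<in> W then (\<Sum>u\<in>S. f a (Inr (b, u))) * q / s else 0)" for a b
  proof -
    have "(\<Sum>k\<in>Inr ` (W \<times> S). f a k * X k (Inl b)) =
        (\<Sum>w\<in>W. \<Sum>u\<in>S. f a (Inr (w, u)) * (if w = b then q / s else 0))"
      by (simp add: sum.reindex sum.cartesian_product X_def case_prod_unfold)
    also have "\<dots> = (\<Sum>w\<in>W. if w = b then (\<Sum>u\<in>S. f a (Inr (w, u))) * q / s else 0)"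
      by (intro sum.cong) (simp_all add: sum_distrib_right sum_divide_distrib)
    finally show ?thesis using fin_W by simp
  qed
  have "det_on (Inl ` V \<union> Inr ` (W \<times> S)) f =
      det_on (Inl ` V) (\<lambda>a b. f a b - (\<Sum>k\<in>Inr ` (W \<times> S). f a k * X k b))
      * det_on (Inr ` (W \<times> S)) f"
  proof (rule det_on_schur)
    fix t b :: "'a + 'a \<times> 'b" assume "t \<in> Inr ` (W \<times> S)" "b \<in> Inl ` V"
    then obtain w u a where t: "t = Inr (w, u)" "w \<in> W" "u \<in> S" and b: "b = Inl a" by auto
    show "f t b = (\<Sum>k\<in>Inr ` (W \<times> S). f t k * X k b)"
      unfolding b sum_copies using t row_sums[OF t(3)] assms(4) by (simp add: lower_left copies)
  qed (use assms(1,3) fin_W in auto)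
  also have "det_on (Inl ` V) (\<lambda>a b. f a b - (\<Sum>k\<in>Inr ` (W \<times> S). f a k * X k b)) =
      det_on V (\<lambda>a b. f (Inl a) (Inl b)
        - (if a = b \<and> a \<in> W then p * q * of_nat (card S) / s else 0))"
    using assms(1) by (subst det_on_image) (auto simp: sum_copies upper_right intro!: det_on_cong)
  also have "det_on (Inr ` (W \<times> S)) f = det_on S g ^ card W"
  proof -
    have "det_on (Inr ` (W \<times> S)) f =
        det_on (W \<times> S) (\<lambda>k l. if fst k = fst l then g (snd k) (snd l) else 0)"
      using fin_W assms(3) by (subst det_on_image) (auto simp: copies intro!: det_on_cong)
    then show ?thesis using det_on_block_diag[OF fin_W assms(3)] by simp
  qed
  finally show ?thesis .
qed

lemma det_on_zero_row_sums:
  fixes f :: "'a \<Rightarrow> 'a \<Rightarrow> 'k :: idom"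
  assumes "finite S" "S \<noteq> {}" and row_sums: "\<And>a. a \<in> S \<Longrightarrow> (\<Sum>b\<in>S. f a b) = 0"
  shows "det_on S f = 0"
proof -
  obtain a where a: "a \<in> S" using assms(2) by blast
  have column: "f t a = (\<Sum>k\<in>S - {a}. f t k * - 1)" if "t \<in> S" for t
    using row_sums[OF that] sum.remove[OF assms(1) a, of "f t"]
    by (simp add: sum_negf eq_neg_iff_add_eq_0)
  have "det_on ({a} \<union> (S - {a})) f =
      det_on {a} (\<lambda>t s. f t s - (\<Sum>k\<in>S - {a}. f t k * - 1)) * det_on (S - {a}) f"
    by (rule det_on_schur) (use assms(1) column in auto)
  then show ?thesis using a column[OF a] by (simp add: insert_absorb)
qed

section \<open>Real spectra\<close>

lemma quadratic_form_zero_row_sums: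
  fixes f :: "'i \<Rightarrow> 'i \<Rightarrow> real" and x :: "'i \<Rightarrow> complex"
  assumes sym: "\<And>i j. i \<in> I \<Longrightarrow> j \<in> I \<Longrightarrow> f i j = f j i"
    and row_sums: "\<And>i. i \<in> I \<Longrightarrow> (\<Sum>j\<in>I. f i j) = 0"
  shows "(\<Sum>i\<in>I. \<Sum>j\<in>I. of_real (f i j) * x j * cnj (x i)) =
    of_real (- (\<Sum>i\<in>I. \<Sum>j\<in>I. f i j * (cmod (x i - x j))\<^sup>2) / 2)"
proof -
  define B where "B i j = of_real (f i j) * x j * cnj (x i)" for i j
  define D where "D i j = f i j * (cmod (x i))\<^sup>2" for i j
  have D: "(\<Sum>i\<in>I. \<Sum>j\<in>I. D i j) = 0"
    by (simp add: D_def row_sums flip: sum_distrib_right)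
  then have D_swap: "(\<Sum>i\<in>I. \<Sum>j\<in>I. D j i) = 0"
    by (subst sum.swap)
  have B_swap: "(\<Sum>i\<in>I. \<Sum>j\<in>I. B j i) = (\<Sum>i\<in>I. \<Sum>j\<in>I. B i j)"
    by (rule sum.swap)
  have "of_real (f i j * (cmod (x i - x j))\<^sup>2) = of_real (D i j) + of_real (D j i) - B i j - B j i"
    if "i \<in> I" "j \<in> I" for i j
    unfolding B_def D_def of_real_mult complex_norm_square
    using sym[OF that] by (simp add: algebra_simps)
  then have "of_real (\<Sum>i\<in>I. \<Sum>j\<in>I. f i j * (cmod (x i - x j))\<^sup>2) =
      (\<Sum>i\<in>I. \<Sum>j\<in>I. of_real (D i j) + of_real (D j i) - B i j - B j i)"
    by (simp only: of_real_sum cong: sum.cong)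
  also have "\<dots> = - 2 * (\<Sum>i\<in>I. \<Sum>j\<in>I. B i j)"
    using D D_swap by (simp add: sum_subtractf sum.distrib B_swap flip: of_real_sum)
  finally show ?thesis by (simp add: B_def)
qed

lemma eigenvalue_zero_row_sums_nonneg:
  fixes A :: "real mat"
  assumes A: "A \<in> carrier_mat n n"
    and sym: "\<And>i j. i < n \<Longrightarrow> j < n \<Longrightarrow> A $$ (i, j) = A $$ (j, i)"
    and row_sums: "\<And>i. i < n \<Longrightarrow> (\<Sum>j = 0..<n. A $$ (i, j)) = 0"
    and off_diag: "\<And>i j. i < n \<Longrightarrow> j < n \<Longrightarrow> i \<noteq> j \<Longrightarrow> A $$ (i, j) \<le> 0"
    and z: "eigenvalue (map_mat complex_of_real A) z"
  shows "0 \<le> z"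
proof -
  let ?A = "map_mat complex_of_real A"
  obtain v where v: "v \<in> carrier_vec n" "v \<noteq> 0\<^sub>v n" "?A *\<^sub>v v = z \<cdot>\<^sub>v v"
    using z A by (auto simp: eigenvalue_def eigenvector_def)
  define Q where "Q = - (\<Sum>i = 0..<n. \<Sum>j = 0..<n. A $$ (i, j) * (cmod (v $ i - v $ j))\<^sup>2) / 2"
  have "A $$ (i, j) * (cmod (v $ i - v $ j))\<^sup>2 \<le> 0" if "i < n" "j < n" for i j
    using off_diag[OF that] by (cases "i = j") (simp_all add: mult_nonpos_nonneg)
  then have Q: "Q \<ge> 0"
    unfolding Q_def by (auto intro!: divide_nonneg_pos sum_nonpos)
  have "z * (v \<bullet>c v) = (?A *\<^sub>v v) \<bullet>c v"
    using v by simp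
  also have "\<dots> = (\<Sum>i = 0..<n. \<Sum>j = 0..<n. of_real (A $$ (i, j)) * v $ j * cnj (v $ i))"
    using A v(1) by (simp add: scalar_prod_def sum_distrib_right)
  also have "\<dots> = of_real Q"
    unfolding Q_def by (rule quadratic_form_zero_row_sums) (simp_all add: sym row_sums)
  finally have "z * (v \<bullet>c v) = of_real Q" .
  moreover have "v \<bullet>c v > 0"
    using v(1,2) by simp
  ultimately show ?thesis
    using Q by (auto simp: less_eq_complex_def less_complex_def complex_eq_iff zero_le_mult_iff)
qed

lemma char_poly_factorized_nonneg:
  fixes A :: "real mat"
  assumes A: "A \<in> carrier_mat n n"
    and nonneg: "\<And>z. eigenvalue (map_mat complex_of_real A) z \<Longrightarrow> 0 \<le> z"
  obtains rs where "char_poly A = (\<Prod>r\<leftarrow>rs. [:- r, 1:])" "length rs = n" "\<forall>r\<in>set rs. 0 \<le> r"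
proof -
  let ?A = "map_mat complex_of_real A"
  have A_complex: "?A \<in> carrier_mat n n" using A by simp
  obtain zs where zs: "char_poly ?A = (\<Prod>z\<leftarrow>zs. [:- z, 1:])" "length zs = n"
    using char_poly_factorized[OF A_complex] by blast
  have zs_nonneg: "0 \<le> z" if "z \<in> set zs" for z
  proof (rule nonneg)
    have "poly (char_poly ?A) z = 0"
      using that unfolding zs(1) by (auto simp: poly_prod_list prod_list_zero_iff image_iff)
    then show "eigenvalue ?A z"
      using eigenvalue_root_char_poly[OF A_complex] by simp
  qed
  then have zs_real: "complex_of_real (Re z) = z" if "z \<in> set zs" for z
    using nonnegative_complex_is_real[of z] that by simp
  interpret h: map_poly_inj_comm_ring_hom complex_of_real ..
  have "map_poly complex_of_real (char_poly A) = (\<Prod>z\<leftarrow>zs. [:- z, 1:])"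
    using zs(1) of_real_hom.char_poly_hom[OF A, where 'a = complex] by simp
  also have "\<dots> = map_poly complex_of_real (\<Prod>r\<leftarrow>map Re zs. [:- r, 1:])"
    unfolding h.hom_prod_list map_map
    by (intro arg_cong[where f = prod_list] map_cong) (simp_all add: zs_real)
  finally have "char_poly A = (\<Prod>r\<leftarrow>map Re zs. [:- r, 1:])"
    by (simp only: h.eq_iff)
  then show ?thesis
    using that[of "map Re zs"] zs(2) zs_nonneg by (auto simp: less_eq_complex_def)
qed

lemma sorted_proots_linear_factors:
  fixes rs :: "'k :: {idom, linorder} list"
  shows "sorted_list_of_multiset (proots (\<Prod>r\<leftarrow>rs. [:- r, 1:])) = sort rs"
proof -
  have "proots (\<Prod>r\<leftarrow>rs. [:- r, 1:]) = (\<Sum>r\<leftarrow>rs. {#r#})"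
    using proots_prod_list[of "map (\<lambda>r. [:- r, 1:]) rs"] by (simp add: image_iff comp_def)
  also have "\<dots> = mset rs"
    by (induction rs) simp_all
  finally show ?thesis by simp
qed

section \<open>Laplacian spectra\<close>

definition laplacian :: "'a pair_pre_digraph \<Rightarrow> 'a \<Rightarrow> 'a \<Rightarrow> 'k :: comm_ring_1" where
  "laplacian G a b = (if a = b then of_nat (out_degree (with_proj G) a) else 0)
     - of_bool ((a, b) \<in> parcs G)"

definition laplacian_det :: "'a pair_pre_digraph \<Rightarrow> 'k :: comm_ring_1 \<Rightarrow> 'k" where
  "laplacian_det G y = det_on (pverts G) (\<lambda>a b. (if a = b then y else 0) - laplacian G a b)"

lemma out_degree_conv_Image: "out_degree (with_proj G) a = card (parcs G `` {a})"
proof -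
  have "out_arcs (with_proj G) a = Pair a ` (parcs G `` {a})"
    by (auto simp: out_arcs_def)
  then show ?thesis
    by (simp add: out_degree_def card_image inj_on_def)
qed

lemma laplacian_sym:
  assumes "pair_graph G"
  shows "laplacian G a b = laplacian G b a"
proof -
  interpret pair_graph G by fact
  show ?thesis using arcs_symmetric by (auto simp: laplacian_def)
qed

lemma laplacian_row_sum:
  assumes "pair_graph G" "a \<in> pverts G"
  shows "(\<Sum>b\<in>pverts G. laplacian G a b) = 0"
proof -
  interpret pair_graph G by fact
  have "parcs G `` {a} = pverts G \<inter> {b. (a, b) \<in> parcs G}"
    by (auto dest: in_arcsD2)
  then show ?thesis
    using assms(2) by (simp add: laplacian_def sum_subtractf out_degree_conv_Image)
qed

lemma laplacian_mat_carrier [simp]: "laplacian_mat vs G \<in> carrier_mat (length vs) (length vs)"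
  by (simp add: laplacian_mat_def degree_mat_def adjacency_mat_def minus_carrier_mat)

lemma laplacian_mat_eq_list_mat:
  assumes "distinct vs"
  shows "laplacian_mat vs G = list_mat vs vs (laplacian G)"
  using assms
  by (auto simp: laplacian_mat_def degree_mat_def adjacency_mat_def list_mat_def laplacian_def
      nth_eq_iff_index_eq intro!: eq_matI)

lemma laplacian_mat_eigenvalue_nonneg:
  assumes G: "pair_graph G" and vs: "distinct vs" "set vs = pverts G"
    and z: "eigenvalue (map_mat complex_of_real (laplacian_mat vs G)) z"
  shows "0 \<le> z"
proof (rule eigenvalue_zero_row_sums_nonneg)
  let ?L = "laplacian_mat vs G"
  show "?L \<in> carrier_mat (length vs) (length vs)" by simp
  fix i assume i: "i < length vs"
  then show "(\<Sum>j = 0..<length vs. ?L $$ (i, j)) = 0"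
    using nth_mem[OF i]
    by (simp add: laplacian_mat_eq_list_mat[OF vs(1)] sum_nth_distinct[OF vs(1)] vs(2)
        laplacian_row_sum[OF G])
  fix j assume j: "j < length vs"
  show "?L $$ (i, j) = ?L $$ (j, i)"
    using i j laplacian_sym[OF G] by (simp add: laplacian_mat_eq_list_mat[OF vs(1)])
  show "?L $$ (i, j) \<le> 0" if "i \<noteq> j"
    using i j that vs(1) by (simp add: laplacian_mat_eq_list_mat laplacian_def nth_eq_iff_index_eq)
qed (rule z)

lemma laplacian_eig_factorization:
  assumes "pair_graph G" "enumerates vs G"
  obtains rs where "char_poly (laplacian_mat vs G) = (\<Prod>r\<leftarrow>rs. [:- r, 1:])"
    "length rs = card (pverts G)" "\<forall>r\<in>set rs. 0 \<le> r" "sorted rs"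
    "laplacian_eig vs G = (\<lambda>i. rs ! (i - 1))"
proof -
  have vs: "distinct vs" "set vs = pverts G"
    using assms(2) by (simp_all add: enumerates_def)
  obtain rs where rs: "char_poly (laplacian_mat vs G) = (\<Prod>r\<leftarrow>rs. [:- r, 1:])"
    "length rs = length vs" "\<forall>r\<in>set rs. 0 \<le> r"
    using char_poly_factorized_nonneg[OF laplacian_mat_carrier]
      laplacian_mat_eigenvalue_nonneg[OF assms(1) vs] by blast
  have "char_poly (laplacian_mat vs G) = (\<Prod>r\<leftarrow>sort rs. [:- r, 1:])"
    by (simp only: rs(1) prod_mset_prod_list[symmetric] mset_map mset_sort)
  moreover have "laplacian_eig vs G = (\<lambda>i. sort rs ! (i - 1))"
    by (simp add: laplacian_eig_def rs(1) fun_eq_iff sorted_proots_linear_factors)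
  ultimately show ?thesis
    using that[of "sort rs"] rs(2,3) distinct_card[OF vs(1)] vs(2) by simp
qed

lemma char_poly_laplacian_mat:
  assumes "pair_graph G" "enumerates vs G"
  shows "char_poly (laplacian_mat vs G) = (\<Prod>i = 1..card (pverts G). [:- laplacian_eig vs G i, 1:])"
proof -
  obtain rs where rs: "char_poly (laplacian_mat vs G) = (\<Prod>r\<leftarrow>rs. [:- r, 1:])"
    "length rs = card (pverts G)" "laplacian_eig vs G = (\<lambda>i. rs ! (i - 1))"
    using laplacian_eig_factorization[OF assms] by blast
  have "(\<Prod>r\<leftarrow>rs. [:- r, 1:]) = (\<Prod>i = 0..<length rs. [:- (rs ! i), 1:])"
    by (simp add: prod.list_conv_set_nth)
  also have "\<dots> = (\<Prod>i = 1..length rs. [:- (rs ! (i - 1)), 1:])"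
    by (rule prod.reindex_bij_witness[of _ "\<lambda>i. i - 1" Suc]) auto
  finally show ?thesis by (simp add: rs)
qed

lemma poly_char_poly_laplacian_mat:
  fixes h :: "real \<Rightarrow> 'k :: comm_ring_1"
  assumes "comm_ring_hom h" "enumerates vs G"
  shows "poly (map_poly h (char_poly (laplacian_mat vs G))) y = laplacian_det G y"
proof -
  interpret comm_ring_hom h by fact
  have vs: "distinct vs" "set vs = pverts G"
    using assms(2) by (simp_all add: enumerates_def)
  have "h (laplacian G a b) = laplacian G a b" for a b
    by (simp add: laplacian_def hom_distribs)
  then have "map_mat h (laplacian_mat vs G) = list_mat vs vs (laplacian G)"
    by (auto simp: laplacian_mat_eq_list_mat[OF vs(1)] list_mat_def)
  then have "map_poly h (char_poly (laplacian_mat vs G)) =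
      char_poly (list_mat vs vs (laplacian G))"
    by (simp flip: char_poly_hom[OF laplacian_mat_carrier])
  also have "poly \<dots> y = det (list_mat vs vs (\<lambda>a b. (if a = b then y else 0) - laplacian G a b))"
    unfolding char_poly_def
    by (rule poly_det_cong[OF list_mat_carrier char_poly_matrix_closed[OF list_mat_carrier]])
       (use vs(1) in \<open>auto simp: char_poly_matrix_def list_mat_def nth_eq_iff_index_eq\<close>)
  finally show ?thesis
    by (simp add: laplacian_det_def det_on_set[OF vs(1)] flip: vs(2))
qed

lemma laplacian_det_eq_prod:
  fixes h :: "real \<Rightarrow> 'k :: comm_ring_1"
  assumes "comm_ring_hom h" "pair_graph G" "enumerates vs G"
  shows "laplacian_det G y = (\<Prod>i = 1..card (pverts G). y - h (laplacian_eig vs G i))"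
proof -
  interpret h: comm_ring_hom h by fact
  interpret map_poly_comm_ring_hom h ..
  show ?thesis
    by (simp add: hom_prod poly_prod h.hom_uminus char_poly_laplacian_mat[OF assms(2,3)]
        flip: poly_char_poly_laplacian_mat[OF assms(1,3)])
qed

lemma laplacian_eig_1:
  assumes "pair_graph G" "enumerates vs G" "pverts G \<noteq> {}"
  shows "laplacian_eig vs G 1 = 0"
proof -
  interpret pair_graph G by fact
  have "laplacian_det G (0 :: real) = 0"
    unfolding laplacian_det_def
    by (rule det_on_zero_row_sums) (simp_all add: assms(3) sum_negf laplacian_row_sum[OF assms(1)])
  then obtain i where i: "i \<in> {1..card (pverts G)}" "laplacian_eig vs G i = 0"
    using laplacian_det_eq_prod[OF of_real_hom.comm_ring_hom_axioms assms(1,2), of "0 :: real"]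
    by auto
  obtain rs where rs: "char_poly (laplacian_mat vs G) = (\<Prod>r\<leftarrow>rs. [:- r, 1:])"
    "length rs = card (pverts G)" "\<forall>r\<in>set rs. 0 \<le> r" "sorted rs"
    "laplacian_eig vs G = (\<lambda>i. rs ! (i - 1))"
    using laplacian_eig_factorization[OF assms(1,2)] by blast
  have "rs ! 0 \<le> rs ! (i - 1)" "0 \<le> rs ! 0"
    using i(1) rs(2,3) by (auto intro: sorted_nth_mono[OF rs(4)])
  then show ?thesis using i(2) by (simp add: rs(5))
qed

section \<open>The subdivision-edge corona\<close>

lemma card_uedge:
  assumes "pair_graph G" "e \<in> uedges G"
  shows "card e = 2"
proof -
  interpret pair_graph G by fact
  obtain u v where "e = {u, v}" "(u, v) \<in> parcs G"
    using assms(2) by (auto simp: uedges_def)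
  moreover have "u \<noteq> v" using pair_no_loops[OF calculation(2)] by simp
  ultimately show ?thesis by simp
qed

lemma card_incident_uedges:
  assumes "pair_graph G"
  shows "card {e \<in> uedges G. v \<in> e} = out_degree (with_proj G) v"
proof -
  interpret pair_graph G by fact
  have "{e \<in> uedges G. v \<in> e} = (\<lambda>w. {v, w}) ` (parcs G `` {v})"
  proof (intro equalityI subsetI)
    fix e assume "e \<in> {e \<in> uedges G. v \<in> e}"
    then obtain a b where "e = {a, b}" "(a, b) \<in> parcs G" "v = a \<or> v = b"
      by (auto simp: uedges_def)
    then show "e \<in> (\<lambda>w. {v, w}) ` (parcs G `` {v})"
      using arcs_symmetric[of a b] by (auto simp: insert_commute)
  qed (auto simp: uedges_def)
  moreover have "inj_on (\<lambda>w. {v, w}) (parcs G `` {v})"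
    by (auto simp: inj_on_def doubleton_eq_iff)
  ultimately show ?thesis by (simp add: card_image out_degree_conv_Image)
qed

lemma uedges_containing_both:
  assumes "pair_graph G" "v \<noteq> w"
  shows "{e \<in> uedges G. v \<in> e \<and> w \<in> e} = (if (v, w) \<in> parcs G then {{v, w}} else {})"
proof -
  interpret pair_graph G by fact
  show ?thesis using assms(2) arcs_symmetric[of w v] by (auto simp: uedges_def)
qed

lemma incidence_mult_transpose:
  assumes "pair_graph G"
  shows "(\<Sum>e\<in>uedges G. of_bool (v \<in> e) * of_bool (w \<in> e)) =
    (if v = w then 2 * of_nat (out_degree (with_proj G) v) else 0) - laplacian G v w"
proof -
  interpret pair_graph G by fact
  have no_loop: "(w, w) \<notin> parcs G" using pair_no_loops[of "(w, w)"] by auto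
  have "{e \<in> uedges G. v \<in> e \<and> w \<in> e} = uedges G \<inter> {e. v \<in> e \<and> w \<in> e}"
    by auto
  then have "(\<Sum>e\<in>uedges G. of_bool (v \<in> e) * of_bool (w \<in> e)) =
      of_nat (card {e \<in> uedges G. v \<in> e \<and> w \<in> e})"
    using finite_uedges[OF assms] by (simp only: sum_of_bool_eq of_bool_conj[symmetric])
  also have "\<dots> = (if v = w then 2 * of_nat (out_degree (with_proj G) v) else 0) - laplacian G v w"
    using card_incident_uedges[OF assms, of v] uedges_containing_both[OF assms, of v w] no_loop
    by (auto simp: laplacian_def)
  finally show ?thesis .
qed

lemma parcs_subdivision_graph_iff [simp]:
  "(Inl v, Inl w) \<notin> parcs (subdivision_graph G)"
  "(Inr e, Inr e') \<notin> parcs (subdivision_graph G)"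
  "(Inl v, Inr e) \<in> parcs (subdivision_graph G) \<longleftrightarrow> e \<in> uedges G \<and> v \<in> e"
  "(Inr e, Inl v) \<in> parcs (subdivision_graph G) \<longleftrightarrow> e \<in> uedges G \<and> v \<in> e"
  by (auto simp: subdivision_graph_def)

lemma out_degree_subdivision_Inl:
  assumes "pair_graph G"
  shows "out_degree (with_proj (subdivision_graph G)) (Inl v) = out_degree (with_proj G) v"
proof -
  have "parcs (subdivision_graph G) `` {Inl v} = Inr ` {e \<in> uedges G. v \<in> e}"
    by (auto simp: subdivision_graph_def)
  then show ?thesis
    by (simp add: out_degree_conv_Image[of "subdivision_graph G"] card_image
        card_incident_uedges[OF assms])
qed

lemma out_degree_subdivision_Inr:
  assumes "pair_graph G" "e \<in> uedges G"
  shows "out_degree (with_proj (subdivision_graph G)) (Inr e) = 2"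
proof -
  have "parcs (subdivision_graph G) `` {Inr e} = Inl ` e"
    using assms(2) by (auto simp: subdivision_graph_def)
  then show ?thesis
    by (simp add: out_degree_conv_Image card_image card_uedge[OF assms])
qed

lemma laplacian_subdivision:
  assumes "pair_graph G"
  shows "laplacian (subdivision_graph G) (Inl v) (Inl w) =
      (if v = w then of_nat (out_degree (with_proj G) v) else 0)"
    and "e \<in> uedges G \<Longrightarrow> laplacian (subdivision_graph G) (Inl v) (Inr e) = - of_bool (v \<in> e)"
    and "e \<in> uedges G \<Longrightarrow> laplacian (subdivision_graph G) (Inr e) (Inl v) = - of_bool (v \<in> e)"
    and "e \<in> uedges G \<Longrightarrow>
      laplacian (subdivision_graph G) (Inr e) (Inr e') = (if e = e' then 2 else 0)"
  using out_degree_subdivision_Inl[OF assms] out_degree_subdivision_Inr[OF assms]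
  by (auto simp: laplacian_def)

lemma det_on_subdivision:
  fixes x c :: "'k :: field"
  assumes G: "pair_graph G" and regular: "regular_graph r G" and c: "c \<noteq> 0"
  shows "det_on (pverts (subdivision_graph G)) (\<lambda>a b.
      (if a = b then if a \<in> inserted_vertices G then c + 2 else x else 0)
      - laplacian (subdivision_graph G) a b) =
    (- 1 / c) ^ card (pverts G) * laplacian_det G (2 * of_nat r - c * (x - of_nat r))
    * c ^ card (uedges G)"
proof -
  interpret pair_graph G by fact
  let ?S = "subdivision_graph G" and ?y = "2 * of_nat r - c * (x - of_nat r)"
  define f where "f a b = (if a = b then if a \<in> inserted_vertices G then c + 2 else x else 0)
    - laplacian ?S a b" for a b
  have old_old: "f (Inl v) (Inl w) = (if v = w then x - of_nat r else 0)" if "v \<in> pverts G" for v w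
    using regular that
    by (auto simp: f_def laplacian_subdivision[OF G] inserted_vertices_def regular_graph_def)
  have old_new: "f (Inl v) (Inr e) = of_bool (v \<in> e)" "f (Inr e) (Inl v) = of_bool (v \<in> e)"
    if "e \<in> uedges G" for v e
    using that by (simp_all add: f_def laplacian_subdivision[OF G])
  have new_new: "f (Inr e) (Inr e') = (if e = e' then c else 0)" if "e \<in> uedges G" for e e'
    using that by (auto simp: f_def laplacian_subdivision[OF G] inserted_vertices_def)
  have schur_entry: "f (Inl v) (Inl w) - (\<Sum>e\<in>uedges G. f (Inl v) (Inr e) * f (Inr e) (Inl w)) / c =
      (- 1 / c) * ((if v = w then ?y else 0) - laplacian G v w)" if "v \<in> pverts G" for v w
  proof -
    have "out_degree (with_proj G) v = r"
      using regular that by (simp add: regular_graph_def)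
    then have incidence: "(\<Sum>e\<in>uedges G. f (Inl v) (Inr e) * f (Inr e) (Inl w)) =
        (if v = w then 2 * of_nat r else 0) - laplacian G v w"
      by (auto simp: old_new incidence_mult_transpose[OF G])
    show ?thesis unfolding old_old[OF that] incidence using c by (simp add: field_simps)
  qed
  have "pverts ?S = Inl ` pverts G \<union> Inr ` uedges G"
    by (simp add: subdivision_graph_def inserted_vertices_def)
  then have "det_on (pverts ?S) f =
      det_on (pverts G) (\<lambda>v w. f (Inl v) (Inl w)
        - (\<Sum>e\<in>uedges G. f (Inl v) (Inr e) * f (Inr e) (Inl w)) / c) * c ^ card (uedges G)"
    by (simp only: det_on_schur_scalar_block[OF pair_finite_verts finite_uedges[OF G] c, of f]
        new_new)
  also have "det_on (pverts G) (\<lambda>v w. f (Inl v) (Inl w)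
        - (\<Sum>e\<in>uedges G. f (Inl v) (Inr e) * f (Inr e) (Inl w)) / c) =
      det_on (pverts G) (\<lambda>v w. (- 1 / c) * ((if v = w then ?y else 0) - laplacian G v w))"
    by (rule det_on_cong) (rule schur_entry)
  finally show ?thesis
    unfolding f_def[abs_def] by (simp only: det_on_smult laplacian_det_def)
qed

lemma parcs_corona_iff [simp]:
  "(Inl a, Inl b) \<in> parcs (subdivision_edge_corona G H) \<longleftrightarrow> (a, b) \<in> parcs (subdivision_graph G)"
  "(Inl a, Inr (w, u)) \<in> parcs (subdivision_edge_corona G H) \<longleftrightarrow>
     a = w \<and> w \<in> inserted_vertices G \<and> u \<in> pverts H"
  "(Inr (w, u), Inl a) \<in> parcs (subdivision_edge_corona G H) \<longleftrightarrow>
     a = w \<and> w \<in> inserted_vertices G \<and> u \<in> pverts H"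
  "(Inr (w, u), Inr (w', u')) \<in> parcs (subdivision_edge_corona G H) \<longleftrightarrow>
     w = w' \<and> w \<in> inserted_vertices G \<and> (u, u') \<in> parcs H"
  by (auto simp: subdivision_edge_corona_def)

lemma out_degree_corona_Inl:
  assumes "pair_graph G" "pair_graph H"
  shows "out_degree (with_proj (subdivision_edge_corona G H)) (Inl a) =
    out_degree (with_proj (subdivision_graph G)) a
    + (if a \<in> inserted_vertices G then card (pverts H) else 0)"
proof -
  interpret S: pair_graph "subdivision_graph G"
    using assms(1) by (rule pair_graph_subdivision_graph)
  interpret H: pair_graph H by fact
  have fin: "finite (parcs (subdivision_graph G) `` {a})"
    by (rule finite_Image[OF S.pair_finite_arcs])
  have "parcs (subdivision_edge_corona G H) `` {Inl a} =
      Inl ` (parcs (subdivision_graph G) `` {a})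
      \<union> (if a \<in> inserted_vertices G then (\<lambda>u. Inr (a, u)) ` pverts H else {})"
    by (auto simp: subdivision_edge_corona_def)
  moreover have "card \<dots> = card (parcs (subdivision_graph G) `` {a})
      + (if a \<in> inserted_vertices G then card (pverts H) else 0)"
    using fin by (subst card_Un_disjoint) (auto simp: card_image inj_on_def)
  ultimately show ?thesis by (simp add: out_degree_conv_Image)
qed

lemma out_degree_corona_Inr:
  assumes "pair_graph H" "w \<in> inserted_vertices G" "u \<in> pverts H"
  shows "out_degree (with_proj (subdivision_edge_corona G H)) (Inr (w, u)) =
    1 + out_degree (with_proj H) u"
proof -
  interpret pair_graph H by fact
  have "parcs (subdivision_edge_corona G H) `` {Inr (w, u)} =
      insert (Inl w) ((\<lambda>v. Inr (w, v)) ` (parcs H `` {u}))"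
    using assms(2,3) by (auto simp: subdivision_edge_corona_def)
  moreover have "card \<dots> = 1 + card (parcs H `` {u})"
    using finite_Image[OF pair_finite_arcs, of "{u}"]
    by (subst card_insert_disjoint) (auto simp: card_image inj_on_def)
  ultimately show ?thesis by (simp add: out_degree_conv_Image)
qed

lemma laplacian_corona:
  assumes "pair_graph G" "pair_graph H"
  shows "laplacian (subdivision_edge_corona G H) (Inl a) (Inl b) =
      laplacian (subdivision_graph G) a b
      + (if a = b \<and> a \<in> inserted_vertices G then of_nat (card (pverts H)) else 0)"
    and "w \<in> inserted_vertices G \<Longrightarrow> u \<in> pverts H \<Longrightarrow>
      laplacian (subdivision_edge_corona G H) (Inl a) (Inr (w, u)) = (if a = w then - 1 else 0)"
    and "w \<in> inserted_vertices G \<Longrightarrow> u \<in> pverts H \<Longrightarrow>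
      laplacian (subdivision_edge_corona G H) (Inr (w, u)) (Inl a) = (if a = w then - 1 else 0)"
    and "w \<in> inserted_vertices G \<Longrightarrow> u \<in> pverts H \<Longrightarrow>
      laplacian (subdivision_edge_corona G H) (Inr (w, u)) (Inr (w', u')) =
      (if w = w' then (if u = u' then 1 else 0) + laplacian H u u' else 0)"
  by (auto simp: laplacian_def out_degree_corona_Inl[OF assms] out_degree_corona_Inr[OF assms(2)])

definition corona_pivot :: "'k \<Rightarrow> 'k \<Rightarrow> 'k :: field" where
  "corona_pivot n x = x - 2 - n - n / (x - 1)"

definition corona_quadratic :: "'k \<Rightarrow> 'k \<Rightarrow> 'k :: comm_ring_1" where
  "corona_quadratic n x = x\<^sup>2 - (3 + n) * x + 2"

definition corona_cubic :: "'k \<Rightarrow> 'k \<Rightarrow> 'k \<Rightarrow> 'k \<Rightarrow> 'k :: comm_ring_1" where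
  "corona_cubic r n m x = x ^ 3 - (3 + r + n) * x\<^sup>2 + (2 + r + r * n + m) * x - m"

lemma corona_pivot_mult:
  "x \<noteq> 1 \<Longrightarrow> corona_pivot n x * (x - 1) = corona_quadratic n x"
  by (simp add: corona_pivot_def corona_quadratic_def field_simps power2_eq_square)

lemma corona_cubic_conv_pivot:
  assumes "x \<noteq> 1" "corona_pivot n x \<noteq> 0"
  shows "(- 1 / corona_pivot n x) * (2 * r - corona_pivot n x * (x - r) - m) =
    corona_cubic r n m x / corona_quadratic n x"
proof -
  have "corona_cubic r n m x = corona_quadratic n x * (x - r) + (x - 1) * (m - 2 * r)"
    by (simp add: corona_cubic_def corona_quadratic_def algebra_simps power2_eq_square
        power3_eq_cube)
  also have "\<dots> = corona_quadratic n x * ((x - r) + (m - 2 * r) / corona_pivot n x)"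
    using assms by (simp add: distrib_left flip: corona_pivot_mult)
  finally show ?thesis
    using assms by (simp add: corona_pivot_mult[symmetric] field_simps)
qed

lemma laplacian_det_corona_eliminate_copies:
  fixes x :: "'k :: field"
  assumes G: "pair_graph G" and H: "pair_graph H" and x: "x \<noteq> 1"
  defines "c \<equiv> corona_pivot (of_nat (card (pverts H))) x"
  shows "laplacian_det (subdivision_edge_corona G H) x =
    det_on (pverts (subdivision_graph G)) (\<lambda>a b.
      (if a = b then if a \<in> inserted_vertices G then c + 2 else x else 0)
      - laplacian (subdivision_graph G) a b)
    * laplacian_det H (x - 1) ^ card (uedges G)"
proof -
  let ?K = "subdivision_edge_corona G H" and ?S = "subdivision_graph G"
    and ?W = "inserted_vertices G"
  interpret S: pair_graph ?S using G by (rule pair_graph_subdivision_graph)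
  interpret H: pair_graph H by (rule H)
  define f where "f a b = (if a = b then x else 0) - laplacian ?K a b" for a b
  define g where "g u v = (if u = v then x - 1 else 0) - laplacian H u v" for u v
  have "det_on (Inl ` pverts ?S \<union> Inr ` (?W \<times> pverts H)) f =
      det_on (pverts ?S) (\<lambda>a b. f (Inl a) (Inl b)
        - (if a = b \<and> a \<in> ?W then of_nat (card (pverts H)) / (x - 1) else 0))
      * det_on (pverts H) g ^ card ?W"
  proof (rule det_on_attach_copies[where p = 1 and q = 1, unfolded mult_1])
    show "?W \<subseteq> pverts ?S" by (simp add: subdivision_graph_def)
    show "(\<Sum>v\<in>pverts H. g u v) = x - 1" if "u \<in> pverts H" for u
      using that by (simp add: g_def sum_subtractf laplacian_row_sum[OF H])
  qed (use x in \<open>auto simp: f_def g_def laplacian_corona[OF G H]\<close>)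
  also have "det_on (pverts ?S) (\<lambda>a b. f (Inl a) (Inl b)
        - (if a = b \<and> a \<in> ?W then of_nat (card (pverts H)) / (x - 1) else 0)) =
      det_on (pverts ?S)
        (\<lambda>a b. (if a = b then if a \<in> ?W then c + 2 else x else 0) - laplacian ?S a b)"
    by (rule det_on_cong) (simp add: f_def laplacian_corona(1)[OF G H] c_def corona_pivot_def)
  also have "card ?W = card (uedges G)"
    by (simp add: inserted_vertices_def card_image)
  also have "Inl ` pverts ?S \<union> Inr ` (?W \<times> pverts H) = pverts ?K"
    by (simp add: subdivision_edge_corona_def)
  finally show ?thesis
    by (simp add: laplacian_det_def f_def[abs_def] g_def[abs_def])
qed

lemma laplacian_det_corona:
  fixes x :: "'k :: field"
  assumes G: "pair_graph G" "regular_graph r G" and H: "pair_graph H"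
  defines "c \<equiv> corona_pivot (of_nat (card (pverts H))) x"
  assumes "x \<noteq> 1" "c \<noteq> 0"
  shows "laplacian_det (subdivision_edge_corona G H) x =
    (- 1 / c) ^ card (pverts G) * laplacian_det G (2 * of_nat r - c * (x - of_nat r))
    * c ^ card (uedges G) * laplacian_det H (x - 1) ^ card (uedges G)"
  using laplacian_det_corona_eliminate_copies[OF G(1) H assms(5)] det_on_subdivision[OF G assms(6)]
  by (simp only: c_def)

lemma laplacian_det_corona_eq_prod:
  fixes x :: "'k :: field" and h :: "real \<Rightarrow> 'k"
  assumes h: "comm_ring_hom h"
    and G: "pair_graph G" "regular_graph r G" "enumerates us G"
    and H: "pair_graph H" "enumerates ws H" "pverts H \<noteq> {}"
  defines "n \<equiv> card (pverts H)" and "m \<equiv> card (uedges G)"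
  assumes x: "x \<noteq> 1" and nonzero: "corona_quadratic (of_nat n) x \<noteq> 0"
  shows "laplacian_det (subdivision_edge_corona G H) x =
    corona_quadratic (of_nat n) x powi (int m - int (card (pverts G)))
    * (\<Prod>i = 2..n. x - 1 - h (laplacian_eig ws H i)) ^ m
    * (\<Prod>i = 1..card (pverts G). corona_cubic (of_nat r) (of_nat n) (h (laplacian_eig us G i)) x)"
proof -
  interpret h: comm_ring_hom h by (rule h)
  interpret H: pair_graph H by (rule H(1))
  define c where "c = corona_pivot (of_nat n) x"
  define q where "q = corona_quadratic (of_nat n) x"
  define cubic where "cubic i = corona_cubic (of_nat r) (of_nat n) (h (laplacian_eig us G i)) x"
    for i
  have q: "c * (x - 1) = q" "q \<noteq> 0"
    using corona_pivot_mult[OF x] nonzero by (simp_all add: c_def q_def)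
  then have c: "c \<noteq> 0" by auto
  have "(- 1 / c) ^ card (pverts G) * laplacian_det G (2 * of_nat r - c * (x - of_nat r)) =
      (\<Prod>i = 1..card (pverts G). (- 1 / c)
        * (2 * of_nat r - c * (x - of_nat r) - h (laplacian_eig us G i)))"
    by (simp only: laplacian_det_eq_prod[OF h G(1,3)] prod.distrib) simp
  also have "\<dots> = (\<Prod>i = 1..card (pverts G). cubic i / q)"
    using c unfolding c_def q_def cubic_def by (intro prod.cong refl corona_cubic_conv_pivot x)
  also have "\<dots> = (\<Prod>i = 1..card (pverts G). cubic i) / q ^ card (pverts G)"
    by (simp add: prod_dividef)
  finally have G_part: "(- 1 / c) ^ card (pverts G)
      * laplacian_det G (2 * of_nat r - c * (x - of_nat r)) =
      (\<Prod>i = 1..card (pverts G). cubic i) / q ^ card (pverts G)" .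
  have "{1..n} = insert 1 {2..n}"
    using H(3) by (auto simp: n_def Suc_le_eq card_gt_0_iff)
  then have H_part: "laplacian_det H (x - 1) =
      (x - 1) * (\<Prod>i = 2..n. x - 1 - h (laplacian_eig ws H i))"
    using laplacian_eig_1[OF H]
    by (simp add: laplacian_det_eq_prod[OF h H(1,2)] flip: n_def)
  have "laplacian_det (subdivision_edge_corona G H) x =
      (- 1 / c) ^ card (pverts G) * laplacian_det G (2 * of_nat r - c * (x - of_nat r))
      * c ^ m * laplacian_det H (x - 1) ^ m"
    using laplacian_det_corona[OF G(1,2) H(1) x] c by (simp add: c_def n_def m_def)
  also have "\<dots> = q ^ m / q ^ card (pverts G)
      * (\<Prod>i = 2..n. x - 1 - h (laplacian_eig ws H i)) ^ m * (\<Prod>i = 1..card (pverts G). cubic i)"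
    unfolding G_part H_part by (simp add: power_mult_distrib flip: q(1))
  finally show ?thesis
    using q(2) by (simp add: power_int_diff cubic_def q_def)
qed

section \<open>Evaluation in the field of rational functions\<close>

lemma to_fract_pCons:
  "to_fract (pCons a p) = to_fract [:a:] + to_fract [:0, 1:] * to_fract p"
  by (simp flip: to_fract_add to_fract_mult)

lemma to_fract_eq_poly:
  fixes p :: "'a :: idom poly"
  shows "to_fract p = poly (map_poly (\<lambda>a. to_fract [:a:]) p) (to_fract [:0, 1:])"
proof (induction p)
  case (pCons a p)
  then show ?case by (subst to_fract_pCons) (simp add: map_poly_pCons)
qed simp

lemma comm_ring_hom_to_fract_const:
  "comm_ring_hom (\<lambda>a :: 'a :: idom. to_fract [:a:])"
  by standard (simp_all add: one_pCons[symmetric] flip: to_fract_add to_fract_mult)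

lemma poly_map_corona_quadratic:
  fixes h :: "'r :: comm_ring_1 \<Rightarrow> 'k :: comm_ring_1"
  assumes "comm_ring_hom h"
  shows "poly (map_poly h [:2, - (3 + of_nat n), 1:]) x = corona_quadratic (of_nat n) x"
proof -
  interpret comm_ring_hom h by fact
  show ?thesis
    by (simp add: hom_distribs corona_quadratic_def algebra_simps power2_eq_square)
qed

lemma poly_map_corona_cubic:
  fixes h :: "'r :: comm_ring_1 \<Rightarrow> 'k :: comm_ring_1"
  assumes "comm_ring_hom h"
  shows "poly (map_poly h
      [:- m, 2 + of_nat r + of_nat r * of_nat n + m, - (3 + of_nat r + of_nat n), 1:]) x =
    corona_cubic (of_nat r) (of_nat n) (h m) x"
proof -
  interpret comm_ring_hom h by fact
  show ?thesis
    by (simp add: hom_distribs corona_cubic_def algebra_simps power2_eq_square power3_eq_cube)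
qed

lemma poly_map_shifted_linear:
  fixes h :: "'r :: comm_ring_1 \<Rightarrow> 'k :: comm_ring_1"
  assumes "comm_ring_hom h"
  shows "poly (map_poly h [:- 1 - m, 1:]) x = x - 1 - h m"
proof -
  interpret comm_ring_hom h by fact
  show ?thesis by (simp add: hom_minus hom_uminus)
qed

theorem theorem3p7:
  fixes G1 :: "'a pair_pre_digraph" and G2 :: "'b pair_pre_digraph"
    and r1 n1 m1 n2 :: nat
    and vs1 :: "'a list" and vs2 :: "'b list"
    and vs :: "(('a + 'a set) + ('a + 'a set) \<times> 'b) list"
  assumes "pair_graph G1" and "regular_graph r1 G1"
    and "card (pverts G1) = n1" and "card (uedges G1) = m1"
    and "pair_graph G2" and "card (pverts G2) = n2" and "n2 \<ge> 1"
    and "enumerates vs1 G1" and "enumerates vs2 G2"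
    and "enumerates vs (subdivision_edge_corona G1 G2)"
  shows "to_fract (char_poly (laplacian_mat vs (subdivision_edge_corona G1 G2))) =
    to_fract [:2, - (3 + real n2), 1:] powi (int m1 - int n1)
    * to_fract (\<Prod>i = 2..n2. [:- 1 - laplacian_eig vs2 G2 i, 1:] ^ m1)
    * to_fract (\<Prod>i = 1..n1.
        [:- laplacian_eig vs1 G1 i,
          2 + real r1 + real r1 * real n2 + laplacian_eig vs1 G1 i,
          - (3 + real r1 + real n2),
          1:])"
proof -
  let ?K = "subdivision_edge_corona G1 G2"
  define h :: "real \<Rightarrow> real poly fract" where "h a = to_fract [:a:]" for a
  define x where "x = to_fract [:0, 1 :: real:]"
  have h: "comm_ring_hom h"
    unfolding h_def by (rule comm_ring_hom_to_fract_const)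
  then interpret map_poly_comm_ring_hom h
    by (rule map_poly_comm_ring_hom.intro)
  have eval: "to_fract p = poly (map_poly h p) x" for p
    unfolding h_def x_def by (rule to_fract_eq_poly)
  note factors = poly_map_corona_quadratic[OF h] poly_map_shifted_linear[OF h]
    poly_map_corona_cubic[OF h]
  have "x \<noteq> 1" by (simp add: x_def one_pCons flip: to_fract_1)
  moreover have "corona_quadratic (of_nat n2) x \<noteq> 0"
    unfolding poly_map_corona_quadratic[OF h, symmetric] eval[symmetric] by simp
  moreover have "pverts G2 \<noteq> {}" using assms(6,7) by auto
  ultimately have "laplacian_det ?K x = corona_quadratic (of_nat n2) x powi (int m1 - int n1)
      * (\<Prod>i = 2..n2. x - 1 - h (laplacian_eig vs2 G2 i)) ^ m1
      * (\<Prod>i = 1..n1. corona_cubic (of_nat r1) (of_nat n2) (h (laplacian_eig vs1 G1 i)) x)"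
    using laplacian_det_corona_eq_prod[OF h assms(1,2,8,5,9), of x] assms(3,4,6) by simp
  then show ?thesis
    by (simp only: eval poly_char_poly_laplacian_mat[OF h assms(10)] hom_prod hom_power poly_prod
        poly_power factors prod_power_distrib)
qed

end
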